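(* Let $V:\mathbb{R}\to\mathbb{R}$ and $\mu_0\in(0,V_0)$, where $V_0=\max_{x\in\mathbb{R}}|V(x)|$, be such that $V$ is real-valued on $\mathbb{R}$ and extends analytically to a complex domain $D\subset\mathbb{C}$ containing an open neighborhood of the real line, and $\limsup_{x\to\pm\infty}|V(x)|<\mu_0$. Suppose that $V$ is a single-lobe potential near $\mu_0$, and put $\lambda_0=i\mu_0$. Then there exist positive constants $h_0$ and $\varepsilon$ such that the point spectrum $\sigma_p(P(h))$ of $P(h)$ satisfies $$\sigma_p(P(h))\cap\{\lambda\in\mathbb{C}:|\lambda-\lambda_0|<\varepsilon\}\subset i\mathbb{R}$$ when $0<h\le h_0$.
   Context: For $h>0$, $P(h)$ is the Dirac (Zakharov-Shabat) operator $$P(h)=\begin{pmatrix}-hD_x & iV(x)\\ iV(x) & hD_x\end{pmatrix},\qquad D_x=-i\,\partial/\partial x,$$ viewed as a densely defined operator on $L^2(\mathbb{R};\mathbb{C}^2)$. Eigenvalues are those $\lambda\in\mathbb{C}$ for which $P(h)u=\lambda u$ has a nonzero solution $u\in L^2(\mathbb{R};\mathbb{C}^2)$. Single-lobe potential: for $0<\mu_0<V_0$, $V$ is a single-lobe potential near $\mu_0$ if the equation $V(x)^2-\mu_0^2=0$ has exactly two real solutions $\alpha_l(\mu_0)<\alpha_r(\mu_0)$, and $V'(\alpha_l(\mu_0))\ne0$, $V'(\alpha_r(\mu_0))\neq 0$. *)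

theory Defs
  imports "HOL-Complex_Analysis.Complex_Analysis"
begin

definition L2_fun :: "(real \<Rightarrow> complex ^ 2) \<Rightarrow> bool" where
  "L2_fun u \<longleftrightarrow>
     u \<in> borel_measurable lebesgue \<and> integrable lebesgue (\<lambda>x. (norm (u x))\<^sup>2)"

text \<open>
  \<open>has_ac_deriv u w\<close>: \<open>u\<close> is locally absolutely continuous with almost everywhere derivative
  \<open>w\<close>, expressed as: \<open>u\<close> is an indefinite Lebesgue integral of the locally integrable \<open>w\<close>.
\<close>

definition has_ac_deriv :: "(real \<Rightarrow> complex ^ 2) \<Rightarrow> (real \<Rightarrow> complex ^ 2) \<Rightarrow> bool" where
  "has_ac_deriv u w \<longleftrightarrow>
     (\<forall>a b. a \<le> b \<longrightarrow>
        w absolutely_integrable_on {a..b} \<and> (w has_integral (u b - u a)) {a..b})"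

text \<open>
  The Dirac (Zakharov--Shabat) expression at the point \<open>x\<close>, where \<open>w\<close> is the derivative of
  \<open>u\<close>; thus \<open>- \<i> * w x $ k\<close> is the \<open>k\<close>-th component of \<open>D\<^sub>x u\<close> at \<open>x\<close>.
\<close>

definition dirac_expr ::
    "real \<Rightarrow> (real \<Rightarrow> real) \<Rightarrow> (real \<Rightarrow> complex ^ 2) \<Rightarrow> (real \<Rightarrow> complex ^ 2) \<Rightarrow> real \<Rightarrow> complex ^ 2" where
  "dirac_expr h V u w x = vector
     [ - of_real h * (- \<i> * w x $ 1) + \<i> * of_real (V x) * u x $ 2,
       \<i> * of_real (V x) * u x $ 1 + of_real h * (- \<i> * w x $ 2) ]"

text \<open>
  The graph of \<open>P(h)\<close> on its maximal domain: \<open>dirac_op h V u f\<close> says that \<open>u\<close> is in the domain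
  and \<open>P(h) u = f\<close>. The domain consists of the \<open>u\<close> in \<open>L\<^sup>2\<close> that are locally absolutely
  continuous and have \<open>P(h) u\<close> in \<open>L\<^sup>2\<close>; for bounded \<open>V\<close> this is the Sobolev space \<open>H\<^sup>1\<close>.
  Elements of \<open>L\<^sup>2\<close> are represented by functions, so \<open>u\<close> and \<open>f\<close> matter only up to null sets,
  and \<open>v\<close> is the locally absolutely continuous representative of \<open>u\<close>.
\<close>

definition dirac_op ::
    "real \<Rightarrow> (real \<Rightarrow> real) \<Rightarrow> (real \<Rightarrow> complex ^ 2) \<Rightarrow> (real \<Rightarrow> complex ^ 2) \<Rightarrow> bool" where
  "dirac_op h V u f \<longleftrightarrow>
     L2_fun u \<and> L2_fun f \<and>
     (\<exists>v w. (AE x in lebesgue. u x = v x) \<and> has_ac_deriv v w \<and>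
            (AE x in lebesgue. f x = dirac_expr h V v w x))"

definition point_spectrum ::
    "((real \<Rightarrow> complex ^ 2) \<Rightarrow> (real \<Rightarrow> complex ^ 2) \<Rightarrow> bool) \<Rightarrow> complex set" where
  "point_spectrum T =
     {z. \<exists>u. T u (\<lambda>x. z *s u x) \<and> \<not> (AE x in lebesgue. u x = 0)}"

definition extends_analytically :: "(real \<Rightarrow> real) \<Rightarrow> bool" where
  "extends_analytically V \<longleftrightarrow>
     (\<exists>D F. open D \<and> connected D \<and> range of_real \<subseteq> D \<and> F holomorphic_on D \<and>
            (\<forall>x. F (of_real x) = complex_of_real (V x)))"

definition single_lobe :: "(real \<Rightarrow> real) \<Rightarrow> real \<Rightarrow> bool" where
  "single_lobe V \<mu> \<longleftrightarrow>
     (\<exists>\<alpha>l \<alpha>r. \<alpha>l < \<alpha>r \<and> {x. (V x)\<^sup>2 - \<mu>\<^sup>2 = 0} = {\<alpha>l, \<alpha>r} \<and>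
              deriv V \<alpha>l \<noteq> 0 \<and> deriv V \<alpha>r \<noteq> 0)"

end

theory Submission
  imports Defs
begin

text \<open>
  An eigenfunction for \<open>z = \<i> (a + \<i> b)\<close> solves \<open>h p' = (a + \<i> b) p - V q\<close>,
  \<open>h q' = V p - (a + \<i> b) q\<close>. With \<open>N = |p|\<^sup>2 + |q|\<^sup>2\<close>, \<open>\<Delta> = |p|\<^sup>2 - |q|\<^sup>2\<close> and
  \<open>R + \<i> J = p \<cdot> cnj q\<close> this gives \<open>h J' = 2 b R\<close> and \<open>h \<Delta>' = 2 a N - 4 V R\<close>. Let \<open>s = \<plusminus>1\<close> be
  the sign of \<open>V\<close> in the lobe. If \<open>b \<noteq> 0\<close> and \<open>D > 0\<close> is a weight, then \<open>M = s J / b + \<Delta> / (2 D)\<close>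
  satisfies \<open>h D M' \<ge> (a - |D - s V| - h |D'| / (2 D)) N\<close>. Since \<open>s V > - \<mu>\<^sub>0\<close> everywhere, one can
  choose \<open>D\<close>, constant outside a compact set, with \<open>|D - s V| < \<mu>\<^sub>0\<close> uniformly. For \<open>a\<close> near
  \<open>\<mu>\<^sub>0\<close> and \<open>h\<close> small, \<open>M\<close> is then monotone and dominated by the integrable function \<open>N\<close>, which
  forces \<open>M = 0\<close> and \<open>N = 0\<close>.
\<close>

section \<open>Monotone functions dominated by integrable ones\<close>

text \<open>A nondecreasing \<open>M\<close> that is positive at a point stays at least as large to
  its right, and one that is negative there stays at least as negative to its left. Then
  \<open>N\<close> would be bounded below on a half-line, against integrability. So \<open>M\<close>
  vanishes identically, hence \<open>M'\<close> does, and \<open>lower\<close> leaves no room for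
  \<open>N\<close>.\<close>

lemma integrable_dominating_monotone_eq_0:
  fixes M M' N :: "real \<Rightarrow> real"
  assumes der: "\<And>x. (M has_real_derivative M' x) (at x)"
    and lower: "\<And>x. c * N x \<le> M' x" and c: "c > 0"
    and upper: "\<And>x. \<bar>M x\<bar> \<le> C * N x" and C: "C > 0"
    and nonneg: "\<And>x. 0 \<le> N x" and int: "integrable lebesgue N"
  shows "N x = 0"
proof -
  have M'_nonneg: "0 \<le> M' x" for x
    using lower[of x] c nonneg[of x] by (meson mult_nonneg_nonneg less_imp_le order_trans)
  have mono: "M x \<le> M y" if "x \<le> y" for x y
    by (rule DERIV_nonneg_imp_nondecreasing[OF that]) (use der M'_nonneg in blast)
  \<comment> \<open>Stated for intervals of arbitrary length, so that right and left half-lines are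
    covered at once. By Markov the set \<open>S\<close> has finite measure \<open>K\<close>, yet it
    would contain an interval of length \<open>K + 1\<close>.\<close>
  have not_far: False
    if d: "d > 0" and far: "\<And>K. K > 0 \<Longrightarrow> \<exists>t. \<forall>x\<in>{t..t + K}. d \<le> \<bar>M x\<bar>" for d
  proof -
    define S where "S = {x \<in> space lebesgue. d / C \<le> N x}"
    have S: "S \<in> sets lebesgue"
      using borel_measurable_integrable[OF int] unfolding S_def by measurable
    have "emeasure lebesgue S < \<infinity>"
      using integral_Markov_inequality[OF int, of "d / C"] nonneg d C
      by (auto simp: S_def intro: le_less_trans)
    then obtain K where K: "K \<ge> 0" "emeasure lebesgue S = ennreal K"
      by (cases "emeasure lebesgue S") auto
    obtain t where t: "\<And>x. x \<in> {t..t + (K + 1)} \<Longrightarrow> d \<le> \<bar>M x\<bar>"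
      using far[of "K + 1"] K by (metis add_nonneg_pos zero_less_one)
    have "d / C \<le> N x" if "x \<in> {t..t + (K + 1)}" for x
      using order_trans[OF t[OF that] upper[of x]] C by (simp add: divide_le_eq mult.commute)
    then have "emeasure lebesgue {t..t + (K + 1)} \<le> emeasure lebesgue S"
      by (intro emeasure_mono S) (auto simp: S_def)
    then show False
      using K by (simp add: ennreal_le_iff del: ennreal_plus)
  qed
  have "M y = 0" for y
  proof (rule ccontr)
    assume "M y \<noteq> 0"
    then consider "M y > 0" | "M y < 0" by linarith
    then show False
    proof cases
      case 1
      show False
      proof (rule not_far[OF 1])
        show "\<exists>t. \<forall>x\<in>{t..t + K}. M y \<le> \<bar>M x\<bar>" for K
          using mono[of y] by (intro exI[of _ y]) force
      qed
    next
      case 2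
      show False
      proof (rule not_far[of "- M y"])
        show "\<exists>t. \<forall>x\<in>{t..t + K}. - M y \<le> \<bar>M x\<bar>" for K
          using mono[of _ y] by (intro exI[of _ "y - K"]) force
      qed (use 2 in simp)
    qed
  qed
  then have "M = (\<lambda>_. 0)" by auto
  then have "(M has_real_derivative 0) (at x)" by simp
  then have "M' x = 0"
    by (rule DERIV_unique[OF der])
  then show ?thesis
    using lower[of x] c nonneg[of x] by (simp add: mult_le_0_iff)
qed

section \<open>Eigenfunctions as classical solutions\<close>

text \<open>Bootstrapping: the representative \<open>v\<close> is an indefinite integral, hence
  continuous. The equation then makes its derivative almost everywhere equal to a continuous
  function, so \<open>v\<close> is differentiable at every point and solves the system
  there.\<close>

lemma point_spectrum_dirac_solution:
  assumes z: "z \<in> point_spectrum (dirac_op h V)" and h: "h > 0"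
    and V: "continuous_on UNIV V"
  obtains p q :: "real \<Rightarrow> complex"
  where "\<And>x. (p has_vector_derivative ((- \<i> * z * p x - V x * q x) / h)) (at x)"
    and "\<And>x. (q has_vector_derivative ((\<i> * z * q x + V x * p x) / h)) (at x)"
    and "integrable lebesgue (\<lambda>x. (cmod (p x))\<^sup>2 + (cmod (q x))\<^sup>2)"
    and "\<exists>x. p x \<noteq> 0 \<or> q x \<noteq> 0"
proof -
  obtain u where u: "dirac_op h V u (\<lambda>x. z *s u x)" and nz: "\<not> (AE x in lebesgue. u x = 0)"
    using z by (auto simp: point_spectrum_def)
  then obtain v w where L2: "L2_fun u" and uv: "AE x in lebesgue. u x = v x"
    and ac: "has_ac_deriv v w"
    and eq: "AE x in lebesgue. z *s u x = dirac_expr h V v w x"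
    by (auto simp: dirac_op_def)
  \<comment> \<open>The eigenvalue equation solved for the derivative, with \<open>v\<close> in
    place of \<open>u\<close>.\<close>
  define G :: "real \<Rightarrow> complex ^ 2" where
    "G x = vector [(- \<i> * z * v x $ 1 - V x * v x $ 2) / h, (\<i> * z * v x $ 2 + V x * v x $ 1) / h]" for x
  have wG: "AE x in lebesgue. w x = G x"
    using uv eq
  proof eventually_elim
    case (elim x)
    then have "z *s v x = dirac_expr h V v w x" by simp
    then have 1: "z * v x $ 1 - \<i> * (V x * v x $ 2) = \<i> * (h * w x $ 1)"
      and 2: "z * v x $ 2 - \<i> * (V x * v x $ 1) = \<i> * (- (h * w x $ 2))"
      by (simp_all add: dirac_expr_def vec_eq_iff forall_2)
    have i: "- \<i> * (\<i> * y) = y" for y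
      by (simp flip: mult.assoc)
    have "h * w x $ 1 = - \<i> * z * v x $ 1 - V x * v x $ 2"
      using arg_cong[OF 1, of "\<lambda>y. - \<i> * y"] unfolding i right_diff_distrib by (simp add: mult.assoc)
    moreover have "- (h * w x $ 2) = - \<i> * z * v x $ 2 - V x * v x $ 1"
      using arg_cong[OF 2, of "\<lambda>y. - \<i> * y"] unfolding i right_diff_distrib by (simp add: mult.assoc)
    then have "h * w x $ 2 = \<i> * z * v x $ 2 + V x * v x $ 1"
      by (simp add: neg_equal_iff_equal[symmetric, of "h * w x $ 2"] del: neg_equal_iff_equal)
    ultimately show ?case
      using h by (simp add: G_def vec_eq_iff forall_2 field_simps)
  qed
  have w_int: "w integrable_on {a..b}" and w_has: "a \<le> b \<Longrightarrow> (w has_integral (v b - v a)) {a..b}" for a b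
    using ac by (cases "a \<le> b"; auto simp: has_ac_deriv_def integrable_on_def)+
  \<comment> \<open>The interval of radius 1 only serves to have \<open>x\<close> in the interior of
    a compact interval.\<close>
  have contv: "continuous (at x) v" for x
  proof -
    have "continuous_on {x-1..x+1} (\<lambda>y. v (x - 1) + integral {x-1..y} w)"
      by (intro continuous_intros indefinite_integral_continuous_1 w_int)
    then have "continuous_on {x-1..x+1} v"
      by (rule continuous_on_eq) (use w_has in \<open>force simp: integral_unique\<close>)
    then show ?thesis
      by (rule continuous_on_interior) auto
  qed
  then have contv': "continuous_on S v" for S
    by (simp add: continuous_at_imp_continuous_on)
  have V': "continuous_on S V" for S
    using V continuous_on_subset by blast
  have G_cont: "continuous_on S G" for S
  proof -
    have "continuous_on S (\<lambda>x. G x $ 1)" "continuous_on S (\<lambda>x. G x $ 2)"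
      unfolding G_def vector_2 by (intro continuous_intros contv' V'; use h in simp)+
    then have "continuous_on S (\<lambda>x. G x $ i)" for i
      using exhaust_2[of i] by auto
    then have "continuous_on S (\<lambda>x. \<chi> i. G x $ i)"
      by (rule continuous_on_vec_lambda)
    then show ?thesis by simp
  qed
  \<comment> \<open>Replacing \<open>w\<close> by \<open>G\<close> on a null set keeps the integral,
    so \<open>v\<close> is a primitive of a continuous function and the fundamental theorem applies
    at every point.\<close>
  have G_has: "(G has_integral (v b - v a)) {a..b}" if "a \<le> b" for a b
  proof -
    obtain E where "E \<in> null_sets lebesgue" and E: "{x. w x \<noteq> G x} \<subseteq> E"
      using wG by (auto simp: eventually_ae_filter)
    moreover have "G x = w x" if "x \<notin> E" for x
      using E that by (metis (mono_tags, lifting) mem_Collect_eq subsetD)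
    ultimately have "negligible E" "\<And>x. x \<in> {a..b} - E \<Longrightarrow> G x = w x"
      by (auto simp: negligible_iff_null_sets)
    then show ?thesis
      by (rule has_integral_spike[OF _ _ w_has[OF that]])
  qed
  have dv: "(v has_vector_derivative G x) (at x)" for x
  proof -
    have "((\<lambda>y. integral {x-1..y} G) has_vector_derivative G x) (at x within {x-1..x+1})"
      by (rule integral_has_vector_derivative[OF G_cont]) auto
    from has_vector_derivative_add[OF has_vector_derivative_const this]
    have "((\<lambda>y. v (x - 1) + integral {x-1..y} G) has_vector_derivative G x) (at x within {x-1..x+1})"
      by simp
    then have "(v has_vector_derivative G x) (at x within {x-1..x+1})"
      by (rule has_vector_derivative_transform[rotated 2])
        (use G_has in \<open>force simp: integral_unique\<close>)+
    then show ?thesis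
      by (simp add: at_within_Icc_at)
  qed
  have comp: "((\<lambda>x. v x $ i) has_vector_derivative G x $ i) (at x)" for i x
    by (rule bounded_linear.has_vector_derivative[OF bounded_linear_vec_nth dv])
  have norm_sq: "(norm y)\<^sup>2 = (cmod (y $ 1))\<^sup>2 + (cmod (y $ 2))\<^sup>2" for y :: "complex ^ 2"
    by (simp add: norm_vec_def L2_set_def sum_2)
  have v_meas: "(\<lambda>x. (norm (v x))\<^sup>2) \<in> borel_measurable lebesgue"
    by (intro measurable_completion) (auto intro!: borel_measurable_continuous_onI continuous_intros contv')
  have "integrable lebesgue (\<lambda>x. (norm (v x))\<^sup>2)"
    by (rule integrable_cong_AE_imp[of _ "\<lambda>x. (norm (u x))\<^sup>2"])
      (use L2 uv v_meas in \<open>auto simp: L2_fun_def\<close>)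
  moreover have "\<exists>x. v x $ 1 \<noteq> 0 \<or> v x $ 2 \<noteq> 0"
  proof (rule ccontr)
    assume "\<not> ?thesis"
    then have "v x = 0" for x by (simp add: vec_eq_iff forall_2)
    with uv nz show False by simp
  qed
  ultimately show thesis
    using that[of "\<lambda>x. v x $ 1" "\<lambda>x. v x $ 2"] comp[of 1] comp[of 2]
    by (simp add: G_def norm_sq)
qed

section \<open>Monotone quadratic form of an eigenfunction\<close>

text \<open>Separates the differential identities from the choice of the weight. \<open>gap\<close>
  says that the coefficient of \<open>N\<close> in the lower bound for \<open>h * D x * M' x\<close>
  is at least \<open>e\<close>; the bounds \<open>U\<close> and \<open>d\<close> on \<open>D\<close>
  turn this into the two estimates required of \<open>M\<close> by
  \<open>integrable_dominating_monotone_eq_0\<close>.\<close>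

lemma point_spectrum_dirac_imaginary:
  fixes V D D' :: "real \<Rightarrow> real"
  assumes z: "z \<in> point_spectrum (dirac_op h V)" and h: "h > 0"
    and V: "continuous_on UNIV V" and s: "\<bar>s\<bar> = 1"
    and der: "\<And>x. (D has_real_derivative D' x) (at x)"
    and D: "\<And>x. d \<le> D x" "\<And>x. D x \<le> U" and d: "d > 0"
    and gap: "\<And>x. \<bar>D x - s * V x\<bar> + h * \<bar>D' x\<bar> / (2 * D x) + e \<le> Im z" and e: "e > 0"
  shows "Re z = 0"
proof (rule ccontr)
  assume nz: "Re z \<noteq> 0"
  obtain p q :: "real \<Rightarrow> complex"
    where p: "\<And>x. (p has_vector_derivative ((- \<i> * z * p x - V x * q x) / h)) (at x)"
    and q: "\<And>x. (q has_vector_derivative ((\<i> * z * q x + V x * p x) / h)) (at x)"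
    and int: "integrable lebesgue (\<lambda>x. (cmod (p x))\<^sup>2 + (cmod (q x))\<^sup>2)"
    and nonzero: "\<exists>x. p x \<noteq> 0 \<or> q x \<noteq> 0"
    by (rule point_spectrum_dirac_solution[OF z h V]) (rule that)
  define a b where "a = Im z" and "b = - Re z"
  define p1 p2 q1 q2 where "p1 x = Re (p x)" and "p2 x = Im (p x)"
    and "q1 x = Re (q x)" and "q2 x = Im (q x)" for x
  have p1: "(p1 has_real_derivative (a * p1 x - b * p2 x - V x * q1 x) / h) (at x)" for x
    using bounded_linear.has_vector_derivative[OF bounded_linear_Re p[of x]]
    by (simp add: has_real_derivative_iff_has_vector_derivative p1_def[abs_def] p2_def q1_def a_def b_def
        Re_divide_of_real algebra_simps)
  have p2: "(p2 has_real_derivative (a * p2 x + b * p1 x - V x * q2 x) / h) (at x)" for x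
    using bounded_linear.has_vector_derivative[OF bounded_linear_Im p[of x]]
    by (simp add: has_real_derivative_iff_has_vector_derivative p1_def p2_def[abs_def] q2_def a_def b_def
        Im_divide_of_real algebra_simps)
  have q1: "(q1 has_real_derivative (- a * q1 x + b * q2 x + V x * p1 x) / h) (at x)" for x
    using bounded_linear.has_vector_derivative[OF bounded_linear_Re q[of x]]
    by (simp add: has_real_derivative_iff_has_vector_derivative q1_def[abs_def] q2_def p1_def a_def b_def
        Re_divide_of_real algebra_simps)
  have q2: "(q2 has_real_derivative (- a * q2 x - b * q1 x + V x * p2 x) / h) (at x)" for x
    using bounded_linear.has_vector_derivative[OF bounded_linear_Im q[of x]]
    by (simp add: has_real_derivative_iff_has_vector_derivative q1_def q2_def[abs_def] p2_def a_def b_def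
        Im_divide_of_real algebra_simps)
  \<comment> \<open>Neither \<open>V\<close> nor \<open>a\<close> enters the derivative of
    \<open>J\<close>, which is a multiple of \<open>R\<close>. This allows \<open>J\<close> to
    offset the indefinite term \<open>V * R\<close> in the derivative of \<Delta>.\<close>
  define N \<Delta> R J where "N x = (p1 x)\<^sup>2 + (p2 x)\<^sup>2 + (q1 x)\<^sup>2 + (q2 x)\<^sup>2"
    and "\<Delta> x = (p1 x)\<^sup>2 + (p2 x)\<^sup>2 - (q1 x)\<^sup>2 - (q2 x)\<^sup>2"
    and "R x = p1 x * q1 x + p2 x * q2 x"
    and "J x = p2 x * q1 x - p1 x * q2 x" for x
  have N_nonneg: "0 \<le> N x" for x
    by (simp add: N_def)
  have \<Delta>_le: "\<bar>\<Delta> x\<bar> \<le> N x" for x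
    using zero_le_power2[of "p1 x"] zero_le_power2[of "p2 x"] zero_le_power2[of "q1 x"]
      zero_le_power2[of "q2 x"] unfolding \<Delta>_def N_def by linarith
  have R_le: "2 * \<bar>R x\<bar> \<le> N x" for x
  proof -
    have "2 * R x \<le> N x" "2 * (- R x) \<le> N x"
      using sum_squares_bound[of "p1 x" "q1 x"] sum_squares_bound[of "- p1 x" "q1 x"]
        sum_squares_bound[of "p2 x" "q2 x"] sum_squares_bound[of "- p2 x" "q2 x"]
      unfolding R_def N_def by (simp_all add: algebra_simps)
    then show ?thesis by linarith
  qed
  have J_le: "2 * \<bar>J x\<bar> \<le> N x" for x
  proof -
    have "2 * J x \<le> N x" "2 * (- J x) \<le> N x"
      using sum_squares_bound[of "p2 x" "q1 x"] sum_squares_bound[of "- p2 x" "q1 x"]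
        sum_squares_bound[of "p1 x" "q2 x"] sum_squares_bound[of "- p1 x" "q2 x"]
      unfolding J_def N_def by (simp_all add: algebra_simps)
    then show ?thesis by linarith
  qed
  have Dpos: "D x > 0" for x
    using D(1)[of x] d by linarith
  have b: "b \<noteq> 0" using nz by (simp add: b_def)
  have J': "(J has_real_derivative 2 * b * R x / h) (at x)" for x
    unfolding J_def[abs_def]
    by (rule DERIV_cong[OF DERIV_diff[OF DERIV_mult[OF p2 q1] DERIV_mult[OF p1 q2]]])
      (use h in \<open>simp add: R_def field_simps\<close>)
  have \<Delta>': "(\<Delta> has_real_derivative (2 * a * N x - 4 * V x * R x) / h) (at x)" for x
    unfolding \<Delta>_def[abs_def]
    by (rule DERIV_cong[OF DERIV_diff[OF DERIV_diff[OF DERIV_add[OF DERIV_power[OF p1]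
              DERIV_power[OF p2]] DERIV_power[OF q1]] DERIV_power[OF q2]]])
      (use h in \<open>simp add: R_def N_def field_simps power2_eq_square\<close>)
  \<comment> \<open>Dividing by \<open>b\<close> makes the first term contribute
    \<open>2 * s * R x / h\<close> to the derivative, independently of \<open>b\<close>. Hence the
    lower bound for \<open>M'\<close> does not degrade near the imaginary axis; only the constant
    bounding \<open>M\<close> by \<open>N\<close> does, and that constant merely has to be
    finite.\<close>
  define M where "M x = s * J x / b + \<Delta> x / (2 * D x)" for x
  define M' where
    "M' x = (a * N x + 2 * (s * D x - V x) * R x - h * D' x * \<Delta> x / (2 * D x)) / (h * D x)" for x
  have "(M has_real_derivative M' x) (at x)" for x
  proof -
    have "s * (2 * b * R x / h) / b = 2 * s * R x / h"
      using b by simp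
    then have "s * (2 * b * R x / h) / b
        + ((2 * a * N x - 4 * V x * R x) / h * (2 * D x) - \<Delta> x * (2 * D' x)) / (2 * D x * (2 * D x))
      = M' x"
      unfolding M'_def using h Dpos[of x] by (simp add: field_simps)
    moreover have "(M has_real_derivative s * (2 * b * R x / h) / b
        + ((2 * a * N x - 4 * V x * R x) / h * (2 * D x) - \<Delta> x * (2 * D' x)) / (2 * D x * (2 * D x))) (at x)"
      unfolding M_def[abs_def]
      by (intro DERIV_add DERIV_divide DERIV_cdivide DERIV_cmult J' \<Delta>' der) (use Dpos[of x] in simp)
    ultimately show ?thesis by simp
  qed
  moreover have "e / (h * U) * N x \<le> M' x" for x
  proof -
    have s2: "s * s = 1" using s by (auto simp: abs_if split: if_splits)
    \<comment> \<open>Multiplication by \<open>s\<close> moves the sign from \<open>D\<close> to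
      \<open>V\<close>, the form in which \<open>gap\<close> is given.\<close>
    have "\<bar>s * D x - V x\<bar> = \<bar>s\<bar> * \<bar>s * D x - V x\<bar>"
      using s by simp
    also have "\<dots> = \<bar>D x - s * V x\<bar>"
      using s2 by (simp flip: abs_mult mult.assoc add: right_diff_distrib)
    finally have sD: "\<bar>s * D x - V x\<bar> = \<bar>D x - s * V x\<bar>" .
    have "\<bar>2 * (s * D x - V x) * R x\<bar> = \<bar>D x - s * V x\<bar> * (2 * \<bar>R x\<bar>)"
      by (simp only: abs_mult sD abs_numeral mult_ac)
    also have "\<dots> \<le> \<bar>D x - s * V x\<bar> * N x"
      by (intro mult_left_mono R_le) auto
    finally have 1: "\<bar>2 * (s * D x - V x) * R x\<bar> \<le> \<bar>D x - s * V x\<bar> * N x" .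
    have "\<bar>h * D' x * \<Delta> x / (2 * D x)\<bar> = h * \<bar>D' x\<bar> / (2 * D x) * \<bar>\<Delta> x\<bar>"
      using h Dpos[of x] by (simp add: abs_mult)
    also have "\<dots> \<le> h * \<bar>D' x\<bar> / (2 * D x) * N x"
      using h Dpos[of x] by (intro mult_left_mono \<Delta>_le) auto
    finally have 2: "\<bar>h * D' x * \<Delta> x / (2 * D x)\<bar> \<le> h * \<bar>D' x\<bar> / (2 * D x) * N x" .
    have "(\<bar>D x - s * V x\<bar> + h * \<bar>D' x\<bar> / (2 * D x) + e) * N x \<le> a * N x"
      unfolding a_def by (intro mult_right_mono gap N_nonneg)
    then have 3: "\<bar>D x - s * V x\<bar> * N x + h * \<bar>D' x\<bar> / (2 * D x) * N x + e * N x \<le> a * N x"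
      by (simp only: distrib_right)
    have "e / (h * U) * N x \<le> e * N x / (h * D x)"
      using D(2)[of x] Dpos[of x] h e N_nonneg[of x]
      by (simp add: divide_left_mono mult_left_mono)
    also have "\<dots> \<le> M' x"
      unfolding M'_def using 1 2 3 h Dpos[of x] by (intro divide_right_mono) (linarith, simp)
    finally show ?thesis .
  qed
  moreover have "\<bar>M x\<bar> \<le> (1 / \<bar>b\<bar> + 1 / d) * N x" for x
  proof -
    have "\<bar>s * J x / b\<bar> = \<bar>J x\<bar> / \<bar>b\<bar>"
      by (simp add: abs_mult s)
    also have "\<dots> \<le> N x / \<bar>b\<bar>"
      using J_le[of x] by (intro divide_right_mono) auto
    finally have 1: "\<bar>s * J x / b\<bar> \<le> N x / \<bar>b\<bar>" .
    have "\<bar>\<Delta> x / (2 * D x)\<bar> = \<bar>\<Delta> x\<bar> / (2 * D x)"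
      using Dpos[of x] by simp
    also have "\<dots> \<le> N x / d"
      using \<Delta>_le[of x] d D(1)[of x] by (intro frac_le) auto
    finally have "\<bar>M x\<bar> \<le> N x / \<bar>b\<bar> + N x / d"
      using 1 unfolding M_def by linarith
    then show ?thesis
      by (simp add: distrib_right)
  qed
  moreover have "integrable lebesgue N"
    using int by (simp add: N_def[abs_def] p1_def p2_def q1_def q2_def cmod_power2 add.assoc)
  moreover have "e / (h * U) > 0"
    using e h Dpos[of 0] D(2)[of 0] by simp
  moreover have "1 / \<bar>b\<bar> + 1 / d > 0"
    using b d by (simp add: add_pos_pos)
  ultimately have "N x = 0" for x
    using N_nonneg by (intro integrable_dominating_monotone_eq_0[of M M' "e / (h * U)" N "1 / \<bar>b\<bar> + 1 / d"])
  then have "(cmod (p x))\<^sup>2 + (cmod (q x))\<^sup>2 = 0" for x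
    by (simp add: N_def p1_def p2_def q1_def q2_def cmod_power2 add.assoc)
  then have "p x = 0 \<and> q x = 0" for x
    by (simp add: sum_power2_eq_zero_iff)
  with nonzero show False by blast
qed

section \<open>Regularity of the potential and construction of the weight\<close>

text \<open>Squaring removes the corner of the positive part: the difference quotient at 0 is
  bounded by the increment. The weight uses a positive part only through its square.\<close>

lemma DERIV_max_0_power2: "((\<lambda>t. (max 0 t)\<^sup>2) has_real_derivative 2 * max 0 t) (at t)" for t :: real
proof -
  consider "t > 0" | "t < 0" | "t = 0" by linarith
  then show ?thesis
  proof cases
    case 1
    have "((\<lambda>t. t\<^sup>2) has_real_derivative 2 * max 0 t) (at t)"
      using 1 by (auto intro!: derivative_eq_intros)
    then show ?thesis
      by (rule has_field_derivative_transform_within_open[where S = "{0<..}"]) (use 1 in auto)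
  next
    case 2
    have "((\<lambda>t. 0) has_real_derivative 2 * max 0 t) (at t)"
      using 2 by (auto intro!: derivative_eq_intros)
    then show ?thesis
      by (rule has_field_derivative_transform_within_open[where S = "{..<0}"]) (use 2 in auto)
  next
    case 3
    have "((\<lambda>y::real. (max 0 y)\<^sup>2 / y) \<longlongrightarrow> 0) (at 0)"
    proof (rule Lim_null_comparison[where g = "\<lambda>y. \<bar>y\<bar>"])
      show "\<forall>\<^sub>F y in at 0. norm ((max 0 y)\<^sup>2 / y) \<le> \<bar>y\<bar>" for y :: real
        by (intro always_eventually) (auto simp: max_def power2_eq_square)
    qed (auto intro!: tendsto_eq_intros)
    then show ?thesis
      using 3 by (simp add: has_field_derivative_iff)
  qed
qed

text \<open>Continuity of the derivative comes from holomorphy of \<open>deriv F\<close>; it later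
  bounds the derivative of the weight on a compact interval.\<close>

lemma extends_analytically_imp_C1:
  assumes "extends_analytically V"
  obtains V' where "\<And>x. (V has_real_derivative V' x) (at x)" "continuous_on UNIV V'"
proof -
  obtain S F where S: "open S" "range of_real \<subseteq> S" and F: "F holomorphic_on S"
    and FV: "\<And>x. F (of_real x) = complex_of_real (V x)"
    using assms by (auto simp: extends_analytically_def)
  have V: "V = (\<lambda>x. Re (F (of_real x)))"
    by (simp add: FV)
  have "(F has_field_derivative deriv F (of_real x)) (at (of_real x))" for x :: real
    using S by (intro holomorphic_derivI[OF F]) auto
  then have "((\<lambda>x. F (of_real x)) has_vector_derivative deriv F (of_real x)) (at x)" for x :: real
    by (rule has_vector_derivative_real_field)
  then have "(V has_real_derivative Re (deriv F (of_real x))) (at x)" for x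
    unfolding V has_real_derivative_iff_has_vector_derivative
    by (rule bounded_linear.has_vector_derivative[OF bounded_linear_Re])
  moreover have "continuous_on S (deriv F)"
    using F S by (intro holomorphic_on_imp_continuous_on holomorphic_deriv)
  then have "continuous_on UNIV (\<lambda>x. deriv F (complex_of_real x))"
    by (rule continuous_on_compose2[OF _ continuous_on_of_real_id S(2)])
  then have "continuous_on UNIV (\<lambda>x. Re (deriv F (of_real x)))"
    by (rule continuous_on_Re)
  ultimately show thesis
    by (rule that)
qed

lemma Limsup_abs_less_imp_bounded:
  fixes V :: "real \<Rightarrow> real"
  assumes "Limsup at_top (\<lambda>x. ereal \<bar>V x\<bar>) < ereal \<mu>"
    and "Limsup at_bot (\<lambda>x. ereal \<bar>V x\<bar>) < ereal \<mu>"
  obtains L \<eta> where "\<eta> > 0" "\<And>x. \<bar>x\<bar> \<ge> L \<Longrightarrow> \<bar>V x\<bar> < \<mu> - \<eta>"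
proof -
  \<comment> \<open>A real level strictly between both upper limits and \<mu> leaves the uniform
    margin \<eta> = \<mu> - \<open>c\<close>.\<close>
  obtain c where c: "max (Limsup at_top (\<lambda>x. ereal \<bar>V x\<bar>)) (Limsup at_bot (\<lambda>x. ereal \<bar>V x\<bar>)) < ereal c"
      "ereal c < ereal \<mu>"
    using ereal_dense2[of "max (Limsup at_top (\<lambda>x. ereal \<bar>V x\<bar>)) (Limsup at_bot (\<lambda>x. ereal \<bar>V x\<bar>))" "ereal \<mu>"]
      assms by auto
  then have "\<forall>\<^sub>F x in at_top. \<bar>V x\<bar> < c" "\<forall>\<^sub>F x in at_bot. \<bar>V x\<bar> < c"
    using Limsup_lessD[of at_top "\<lambda>x. ereal \<bar>V x\<bar>" "ereal c"]
      Limsup_lessD[of at_bot "\<lambda>x. ereal \<bar>V x\<bar>" "ereal c"] by simp_all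
  then obtain S T where S: "\<And>x. x \<ge> S \<Longrightarrow> \<bar>V x\<bar> < c" and T: "\<And>x. x \<le> T \<Longrightarrow> \<bar>V x\<bar> < c"
    by (auto simp: eventually_at_top_linorder eventually_at_bot_linorder)
  show thesis
  proof (rule that[of "\<mu> - c" "1 + \<bar>S\<bar> + \<bar>T\<bar>"])
    show "\<bar>V x\<bar> < \<mu> - (\<mu> - c)" if "\<bar>x\<bar> \<ge> 1 + \<bar>S\<bar> + \<bar>T\<bar>" for x
      using that S[of x] T[of x] by linarith
  qed (use c in simp)
qed

text \<open>If \<open>W\<close> reached \<open>- \<mu>\<close>, then \<open>W\<^sup>2 = \<mu>\<^sup>2\<close> would have a solution on one side of \<open>x\<^sub>0\<close> and two on
  the other.\<close>

lemma two_level_points_imp_greater: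
  fixes W :: "real \<Rightarrow> real"
  assumes W: "continuous_on UNIV W" and \<mu>: "\<mu> > 0" and x0: "W x\<^sub>0 > \<mu>"
    and L: "\<And>x. \<bar>x\<bar> \<ge> L \<Longrightarrow> \<bar>W x\<bar> < \<mu>"
    and two: "{x. (W x)\<^sup>2 - \<mu>\<^sup>2 = 0} = {\<alpha>, \<beta>}"
  shows "W x > - \<mu>"
proof (rule ccontr)
  assume "\<not> ?thesis"
  then have x: "W x \<le> - \<mu>" by simp
  have level: "y = \<alpha> \<or> y = \<beta>" if "\<bar>W y\<bar> = \<mu>" for y
  proof -
    have "(W y)\<^sup>2 = \<mu>\<^sup>2"
      unfolding that[symmetric] by simp
    then have "y \<in> {x. (W x)\<^sup>2 - \<mu>\<^sup>2 = 0}"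
      by simp
    then show ?thesis
      unfolding two by simp
  qed
  have cont: "continuous_on S W" for S
    using W continuous_on_subset by blast
  have dec: "\<exists>y. s \<le> y \<and> y \<le> t \<and> W y = c" if "s \<le> t" "W t \<le> c" "c \<le> W s" for s t c
    using IVT2'[OF that(2,3,1) cont] by blast
  have inc: "\<exists>y. s \<le> y \<and> y \<le> t \<and> W y = c" if "s \<le> t" "W s \<le> c" "c \<le> W t" for s t c
    using IVT'[OF that(2,3,1) cont] by blast
  have "\<bar>W (\<bar>x\<^sub>0\<bar> + \<bar>L\<bar>)\<bar> < \<mu>" "\<bar>W (- \<bar>x\<^sub>0\<bar> - \<bar>L\<bar>)\<bar> < \<mu>"
    by (intro L; linarith)+
  then have right: "W (\<bar>x\<^sub>0\<bar> + \<bar>L\<bar>) \<le> \<mu>" and left: "W (- \<bar>x\<^sub>0\<bar> - \<bar>L\<bar>) \<le> \<mu>"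
    by linarith+
  have ends: "x\<^sub>0 \<le> \<bar>x\<^sub>0\<bar> + \<bar>L\<bar>" "- \<bar>x\<^sub>0\<bar> - \<bar>L\<bar> \<le> x\<^sub>0"
    by linarith+
  obtain r where r: "x\<^sub>0 \<le> r" "W r = \<mu>"
    using dec[of x\<^sub>0 "\<bar>x\<^sub>0\<bar> + \<bar>L\<bar>" \<mu>] right x0 ends by auto
  obtain l where l: "l \<le> x\<^sub>0" "W l = \<mu>"
    using inc[of "- \<bar>x\<^sub>0\<bar> - \<bar>L\<bar>" x\<^sub>0 \<mu>] left x0 ends by auto
  obtain m where m: "W m = - \<mu>"
  proof (cases "x \<le> x\<^sub>0")
    case True
    then show ?thesis using inc[of x x\<^sub>0 "- \<mu>"] x x0 \<mu> that by auto
  next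
    case False
    then show ?thesis using dec[of x\<^sub>0 x "- \<mu>"] x x0 \<mu> that by auto
  qed
  \<comment> \<open>If \<open>l = r\<close>, both equal \<open>x\<^sub>0\<close>, where
    \<open>W\<close> exceeds \<mu>; \<open>m\<close> differs from both because \<open>W\<close> has
    the opposite sign there.\<close>
  have "l \<noteq> r" "m \<noteq> l" "m \<noteq> r"
    using r l m x0 \<mu> by auto
  then show False
    using level[of l] level[of r] level[of m] r(2) l(2) m \<mu> by fastforce
qed

text \<open>The weight must be positive and lie between \<open>W\<close> - \<mu> and
  \<open>W\<close> + \<mu> with room \<open>d\<close>. The positive part of \<open>W\<close> - \<mu>
  nearly does this; it is lifted by \<open>d\<close> and its corner is smoothed. Outside a compact
  interval the result is the constant \<open>2 * d\<close>, so its derivative is bounded.\<close>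

lemma exists_dirac_weight:
  fixes W W' :: "real \<Rightarrow> real"
  assumes der: "\<And>x. (W has_real_derivative W' x) (at x)" and W': "continuous_on UNIV W'"
    and \<mu>: "\<mu> > 0" and above: "\<And>x. W x > - \<mu>" and upper: "\<And>x. W x \<le> U"
    and L: "\<And>x. \<bar>x\<bar> \<ge> L \<Longrightarrow> \<bar>W x\<bar> < \<mu> - \<eta>" and \<eta>: "\<eta> > 0"
  obtains D D' :: "real \<Rightarrow> real" and d B C
  where "\<And>x. (D has_real_derivative D' x) (at x)" "d > 0" "B > 0"
    and "\<And>x. d \<le> D x" "\<And>x. D x \<le> C" "\<And>x. \<bar>D' x\<bar> \<le> B" "\<And>x. \<bar>D x - W x\<bar> \<le> \<mu> - d"
proof -
  have W: "continuous_on S W" for S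
    using der by (meson DERIV_isCont continuous_at_imp_continuous_on)
  have W'_cont: "continuous_on S W'" for S
    using W' continuous_on_subset by blast
  define K where "K = {- \<bar>L\<bar>..\<bar>L\<bar>}"
  have K: "compact K" "K \<noteq> {}" by (auto simp: K_def)
  obtain y where y: "\<And>x. x \<in> K \<Longrightarrow> W y \<le> W x"
    using continuous_attains_inf[OF K W] by metis
  obtain B where B: "B > 0" "\<And>x. x \<in> K \<Longrightarrow> \<bar>W' x\<bar> \<le> B"
    using compact_imp_bounded[OF compact_continuous_image[OF W'_cont K(1)]]
    by (auto simp: bounded_pos)
  have far: "\<bar>W x\<bar> < \<mu> - \<eta>" if "x \<notin> K" for x
    using L[of x] that by (auto simp: K_def)
  \<comment> \<open>The weight exceeds the positive part by at most \<open>2 * d\<close>, and a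
    margin \<open>d\<close> must remain: hence the factor 3. The entries of the minimum handle, in
    order, points outside \<open>K\<close>, points with \<open>W\<close> > \<mu>, and points of
    \<open>K\<close>.\<close>
  define d where "d = min (min \<eta> \<mu>) (W y + \<mu>) / 3"
  have d: "d > 0" "3 * d \<le> \<mu>"
    using \<eta> \<mu> above[of y] by (auto simp: d_def)
  have low: "3 * d - \<mu> \<le> W x" for x
  proof (cases "x \<in> K")
    case True
    then show ?thesis using y[of x] by (simp add: d_def)
  next
    case False
    then show ?thesis using far[of x] by (simp add: d_def)
  qed
  define m where "m x = max 0 (W x - \<mu>)" for x
  \<comment> \<open>The summand \<open>d\<^sup>2\<close> keeps the square root away from 0, so the
    weight is differentiable; the root lies between \<open>max (m x) d\<close> and
    \<open>m x + d\<close>.\<close>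
  define D where "D x = d + sqrt ((m x)\<^sup>2 + d\<^sup>2)" for x
  define D' where "D' x = m x * W' x / sqrt ((m x)\<^sup>2 + d\<^sup>2)" for x
  have pos: "(m x)\<^sup>2 + d\<^sup>2 > 0" for x
    using d by (simp add: add_nonneg_pos)
  have m: "0 \<le> m x" for x by (simp add: m_def)
  have m2: "((\<lambda>x. (m x)\<^sup>2) has_real_derivative 2 * m x * W' x) (at x)" for x
    unfolding m_def
    by (rule DERIV_chain2[where f = "\<lambda>t. (max 0 t)\<^sup>2", OF DERIV_max_0_power2])
      (auto intro!: derivative_eq_intros der)
  have 1: "(D has_real_derivative D' x) (at x)" for x
  proof -
    have "((\<lambda>x. (m x)\<^sup>2 + d\<^sup>2) has_real_derivative 2 * m x * W' x + 0) (at x)"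
      by (intro DERIV_add m2 DERIV_const)
    from DERIV_chain2[where f = sqrt, OF DERIV_real_sqrt[OF pos] this]
    have "((\<lambda>x. sqrt ((m x)\<^sup>2 + d\<^sup>2)) has_real_derivative D' x) (at x)"
      by (simp add: D'_def field_simps)
    from DERIV_add[OF DERIV_const this] show ?thesis
      by (simp add: D_def[abs_def])
  qed
  have sqrt_ge: "m x \<le> sqrt ((m x)\<^sup>2 + d\<^sup>2)" "d \<le> sqrt ((m x)\<^sup>2 + d\<^sup>2)" for x
    by (auto intro!: real_le_rsqrt)
  have sqrt_le: "sqrt ((m x)\<^sup>2 + d\<^sup>2) \<le> m x + d" for x
    using m[of x] d by (intro real_le_lsqrt) (auto simp: power2_sum)
  have 2: "\<bar>D x - W x\<bar> \<le> \<mu> - d" for x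
  proof (cases "W x \<le> \<mu>")
    case True
    then have "D x = 2 * d" using d by (simp add: D_def m_def)
    then show ?thesis using low[of x] True d by linarith
  next
    case False
    then have "m x = W x - \<mu>" by (simp add: m_def)
    then show ?thesis
      using sqrt_ge[of x] sqrt_le[of x] d unfolding D_def by linarith
  qed
  have 3: "\<bar>D' x\<bar> \<le> B" for x
  proof (cases "x \<in> K")
    case True
    \<comment> \<open>The smoothing factor is at most 1, so the weight varies no faster than
      \<open>W\<close>.\<close>
    have "\<bar>D' x\<bar> = m x / sqrt ((m x)\<^sup>2 + d\<^sup>2) * \<bar>W' x\<bar>"
      using m[of x] pos[of x] by (simp add: D'_def abs_mult)
    also have "\<dots> \<le> 1 * B"
      using sqrt_ge[of x] B(2)[OF True] m[of x] pos[of x] by (intro mult_mono) auto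
    finally show ?thesis by simp
  next
    case False
    then have "m x = 0" using far[of x] \<eta> by (simp add: m_def)
    then show ?thesis using B by (simp add: D'_def)
  qed
  have 4: "d \<le> D x" for x
    using sqrt_ge[of x] d unfolding D_def by linarith
  have 5: "D x \<le> U + \<mu>" for x
    using 2[of x] upper[of x] d by linarith
  show thesis
    by (rule that[OF 1 d(1) B(1) 4 5 3 2])
qed

section \<open>Choice of sign, weight and constants\<close>

theorem theorem1p2:
  fixes V :: "real \<Rightarrow> real" and V\<^sub>0 \<mu>\<^sub>0 :: real
  assumes V0_attained: "\<exists>x. \<bar>V x\<bar> = V\<^sub>0"
    and V0_upper: "\<And>x. \<bar>V x\<bar> \<le> V\<^sub>0"
    and mu0: "0 < \<mu>\<^sub>0" "\<mu>\<^sub>0 < V\<^sub>0"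
    and analytic: "extends_analytically V"
    and limsup_right: "Limsup at_top (\<lambda>x. ereal \<bar>V x\<bar>) < ereal \<mu>\<^sub>0"
    and limsup_left: "Limsup at_bot (\<lambda>x. ereal \<bar>V x\<bar>) < ereal \<mu>\<^sub>0"
    and lobe: "single_lobe V \<mu>\<^sub>0"
  shows "\<exists>h\<^sub>0>0. \<exists>\<epsilon>>0. \<forall>h. 0 < h \<and> h \<le> h\<^sub>0 \<longrightarrow>
           point_spectrum (dirac_op h V) \<inter> {z. cmod (z - \<i> * of_real \<mu>\<^sub>0) < \<epsilon>}
             \<subseteq> range (\<lambda>t::real. \<i> * of_real t)"
proof -
  obtain V' where V': "\<And>x. (V has_real_derivative V' x) (at x)" "continuous_on UNIV V'"
    using extends_analytically_imp_C1[OF analytic] by metis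
  have V: "continuous_on UNIV V"
    using V'(1) by (meson DERIV_isCont continuous_at_imp_continuous_on)
  obtain L \<eta> where \<eta>: "\<eta> > 0" and L: "\<And>x. \<bar>x\<bar> \<ge> L \<Longrightarrow> \<bar>V x\<bar> < \<mu>\<^sub>0 - \<eta>"
    using Limsup_abs_less_imp_bounded[OF limsup_right limsup_left] by metis
  obtain x0 where x0: "\<bar>V x0\<bar> = V\<^sub>0" using V0_attained by blast
  \<comment> \<open>The sign at a maximum point of |V| makes \<open>s * V\<close> exceed the level
    there; its square, and so the two level points, are those of \<open>V\<close>.\<close>
  define s where "s = sgn (V x0)"
  have s: "\<bar>s\<bar> = 1" "s * V x0 > \<mu>\<^sub>0"
    using x0 mu0 by (auto simp: s_def abs_sgn_eq sgn_mult_abs abs_sgn[symmetric] mult.commute[of "sgn _"])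
  have abs_sV: "\<bar>s * V x\<bar> = \<bar>V x\<bar>" for x
    using s(1) by (simp add: abs_mult)
  have sV2: "(s * V x)\<^sup>2 = (V x)\<^sup>2" for x
    using abs_sV by (metis power2_abs)
  obtain \<alpha> \<beta> where "{x. (V x)\<^sup>2 - \<mu>\<^sub>0\<^sup>2 = 0} = {\<alpha>, \<beta>}"
    using lobe by (auto simp: single_lobe_def)
  then have above: "s * V x > - \<mu>\<^sub>0" for x
    by (intro two_level_points_imp_greater[of "\<lambda>x. s * V x" \<mu>\<^sub>0 x0 L \<alpha> \<beta>] continuous_intros V mu0 s)
      (use L \<eta> in \<open>force simp: abs_sV sV2\<close>)+
  have W: "((\<lambda>x. s * V x) has_real_derivative s * V' x) (at x)" for x
    by (intro DERIV_cmult V')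
  have W': "continuous_on UNIV (\<lambda>x. s * V' x)"
    by (intro continuous_intros V')
  have upper: "s * V x \<le> V\<^sub>0" for x
    using abs_sV[of x] V0_upper[of x] by linarith
  obtain D D' d B C where D: "\<And>x. (D has_real_derivative D' x) (at x)" "d > 0" "B > 0"
    "\<And>x. d \<le> D x" "\<And>x. D x \<le> C" "\<And>x. \<bar>D' x\<bar> \<le> B" "\<And>x. \<bar>D x - s * V x\<bar> \<le> \<mu>\<^sub>0 - d"
  proof (rule exists_dirac_weight[OF W W' mu0(1) above upper _ \<eta>, where L = L])
    show "\<bar>s * V x\<bar> < \<mu>\<^sub>0 - \<eta>" if "\<bar>x\<bar> \<ge> L" for x
      using L[OF that] by (simp add: abs_sV)
  qed (rule that)
  \<comment> \<open>The weight leaves a margin \<open>d\<close>. Half of it pays for the distance of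
    \<open>Im z\<close> from the level, a quarter for
    \<open>h * \<bar>D' x\<bar> / (2 * D x)\<close>, which is at most
    \<open>h * B / (2 * d)\<close>, and the last quarter is \<open>e\<close>.\<close>
  have "Re z = 0" if h: "0 < h" "h \<le> d\<^sup>2 / (2 * B)" and z: "z \<in> point_spectrum (dirac_op h V)"
    and near: "cmod (z - \<i> * of_real \<mu>\<^sub>0) < d / 2" for h z
  proof (rule point_spectrum_dirac_imaginary[OF z h(1) V s(1) D(1) D(4) D(5) D(2), where e = "d / 4"])
    fix x
    have "\<bar>Im z - \<mu>\<^sub>0\<bar> < d / 2"
      using abs_Im_le_cmod[of "z - \<i> * of_real \<mu>\<^sub>0"] near by simp
    moreover have "h * \<bar>D' x\<bar> / (2 * D x) \<le> (d\<^sup>2 / (2 * B) * B) / (2 * d)"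
      using h D(2,3) D(4,6)[of x] by (intro frac_le mult_mono) auto
    then have "h * \<bar>D' x\<bar> / (2 * D x) \<le> d / 4"
      using D(2,3) by (simp add: power2_eq_square)
    ultimately show "\<bar>D x - s * V x\<bar> + h * \<bar>D' x\<bar> / (2 * D x) + d / 4 \<le> Im z"
      using D(7)[of x] by linarith
  qed (use D(2) in simp)
  then have imag: "z \<in> range (\<lambda>t::real. \<i> * of_real t)"
    if "0 < h" "h \<le> d\<^sup>2 / (2 * B)" "z \<in> point_spectrum (dirac_op h V)"
      "cmod (z - \<i> * of_real \<mu>\<^sub>0) < d / 2" for h z
    using that by (intro range_eqI[of _ _ "Im z"]) (simp add: complex_eq_iff)
  show ?thesis
    by (rule exI[of _ "d\<^sup>2 / (2 * B)"], intro conjI, use D(2,3) in simp,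
        rule exI[of _ "d / 2"]) (use D(2) imag in auto)
qed

end
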